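(* For all integers $k\ge2$ and $n\ge0$, \[ \sum_{\ell=1}^{k}(-1)^{\ell}(n+\ell)!\,L(k,\ell) = \begin{cases} 0, & 0\le n\le k-2,\\[4pt] (-1)^k\dfrac{n!\,(n+1)!}{(n-k+1)!}, & n\ge k-1, \end{cases} \] where $L(k,\ell)$ denotes the Lah number.
   Context: The Lah numbers are defined for integers $1\le \ell\le k$ by $L(k,\ell)=\binom{k-1}{\ell-1}\frac{k!}{\ell!}$; equivalently, $L(k,\ell)$ is the number of ways to partition a $k$-element set into $\ell$ nonempty linearly ordered subsets. *)

theory Defs
  imports Complex_Main
begin

(* Meaningful for 1 \<le> l \<le> k only. The value is always an integer there; real division
   is used so that the quotient of factorials is the exact one. *)
definition Lah :: "nat \<Rightarrow> nat \<Rightarrow> real" where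
  "Lah k l = real ((k - 1) choose (l - 1)) * (fact k / fact l)"

end

theory Submission
  imports Defs
begin

text \<open>Since \<open>(n + l)! / l! = n! \<cdot> ((n + l) choose n)\<close>, the sum is, up to the factor \<open>- k! n!\<close>, the
  alternating binomial sum of order \<open>k - 1\<close> of \<open>j \<mapsto> (n + 1 + j) choose n\<close>, that is, an iterated
  finite difference. By Pascal's rule, each difference lowers the bottom entry by one, and it
  annihilates the sequence once the bottom entry is 0.\<close>

text \<open>Pascal's rule splits \<open>Suc m choose Suc j\<close> into \<open>m choose j\<close>
  and \<open>m choose Suc j\<close>; after an index shift the two parts pair up into differences of
  \<open>f\<close>.\<close>

lemma alternating_binomial_sum_Suc:
  fixes f :: "nat \<Rightarrow> 'a::comm_ring_1"
  shows "(\<Sum>j\<le>Suc m. (-1) ^ j * of_nat (Suc m choose j) * f j) =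
    (\<Sum>j\<le>m. (-1) ^ j * of_nat (m choose j) * (f j - f (Suc j)))"
proof -
  \<comment> \<open>The extra term \<open>j = Suc m\<close> vanishes because
    \<open>m choose Suc m\<close> is 0; it lets the shifted sum again run up to
    \<open>m\<close>.\<close>
  have "(\<Sum>j\<le>m. (-1) ^ j * of_nat (m choose j) * f j) =
      (\<Sum>j\<le>Suc m. (-1) ^ j * of_nat (m choose j) * f j)"
    by (simp add: binomial_eq_0)
  also have "\<dots> = f 0 - (\<Sum>j\<le>m. (-1) ^ j * of_nat (m choose Suc j) * f (Suc j))"
    by (subst sum.atMost_Suc_shift) (simp add: sum_negf)
  finally have *: "(\<Sum>j\<le>m. (-1) ^ j * of_nat (m choose j) * f j) = \<dots>" .
  have "(\<Sum>j\<le>Suc m. (-1) ^ j * of_nat (Suc m choose j) * f j) =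
      f 0 - (\<Sum>j\<le>m. (-1) ^ j * of_nat (m choose Suc j) * f (Suc j))
          - (\<Sum>j\<le>m. (-1) ^ j * of_nat (m choose j) * f (Suc j))"
    by (subst sum.atMost_Suc_shift) (simp add: sum_negf sum.distrib sum_subtractf algebra_simps)
  also have "\<dots> = (\<Sum>j\<le>m. (-1) ^ j * of_nat (m choose j) * (f j - f (Suc j)))"
    unfolding right_diff_distrib sum_subtractf * ..
  finally show ?thesis .
qed

text \<open>For \<open>b > 0\<close> each difference is \<open>- ((a + j) choose (b - 1))\<close>,
  whence the sign \<open>(-1) ^ m\<close>. Since \<open>b\<close> drops, the induction keeps it
  arbitrary.\<close>

lemma alternating_binomial_sum_choose:
  "(\<Sum>j\<le>m. (-1) ^ j * of_nat (m choose j) * of_nat ((a + j) choose b)) =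
    (if m \<le> b then (-1) ^ m * of_nat (a choose (b - m)) else (0::'a::comm_ring_1))"
proof (induction m arbitrary: b)
  case 0
  show ?case by simp
next
  case (Suc m)
  show ?case
  proof (cases b)
    case 0
    \<comment> \<open>The sequence is constantly 1, so all its differences vanish.\<close>
    then show ?thesis
      by (subst alternating_binomial_sum_Suc) simp
  next
    case (Suc c)
    have "(\<Sum>j\<le>Suc m. (-1) ^ j * of_nat (Suc m choose j) * of_nat ((a + j) choose b)) =
        - (\<Sum>j\<le>m. (-1) ^ j * of_nat (m choose j) * (of_nat ((a + j) choose c) :: 'a))"
      by (subst alternating_binomial_sum_Suc) (simp add: Suc sum_negf)
    then show ?thesis
      by (simp add: Suc.IH Suc)
  qed
qed

theorem theorem1:
  fixes k n :: nat
  assumes "k \<ge> 2"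
  shows "(\<Sum>l = 1..k. (-1) ^ l * fact (n + l) * Lah k l) =
    (if n \<le> k - 2 then 0
     else (-1) ^ k * (fact n * fact (n + 1) / fact (n + 1 - k)))"
proof -
  obtain m where k: "k = Suc m" and "m \<ge> 1"
    using assms by (cases k) auto
  have fact_ratio: "fact (n + l) / fact l = fact n * real ((n + l) choose n)" for l
    by (simp add: binomial_fact)
  have "(\<Sum>l = 1..k. (-1) ^ l * fact (n + l) * Lah k l) =
      (\<Sum>j\<le>m. (-1) ^ Suc j * fact (n + Suc j) * Lah k (Suc j))"
    unfolding k by (simp only: One_nat_def sum.shift_bounds_cl_Suc_ivl atLeast0AtMost)
  also have "\<dots> = (\<Sum>j\<le>m. - (fact k * fact n) *
      ((-1) ^ j * real (m choose j) * real ((Suc n + j) choose n)))"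
  proof (rule sum.cong[OF refl])
    fix j
    have "(-1) ^ Suc j * fact (n + Suc j) * Lah k (Suc j) =
        - ((-1) ^ j) * fact k * real (m choose j) * (fact (n + Suc j) / fact (Suc j))"
      by (simp add: Lah_def k del: fact_Suc)
    also have "\<dots> = - (fact k * fact n) *
        ((-1) ^ j * real (m choose j) * real ((Suc n + j) choose n))"
      unfolding fact_ratio by simp
    finally show "(-1) ^ Suc j * fact (n + Suc j) * Lah k (Suc j) = \<dots>" .
  qed
  also have "\<dots> = - (fact k * fact n) *
      (if m \<le> n then (-1) ^ m * real (Suc n choose (n - m)) else 0)"
    unfolding sum_distrib_left[symmetric] alternating_binomial_sum_choose ..
  also have "\<dots> = (if n \<le> k - 2 then 0
      else (-1) ^ k * (fact n * fact (n + 1) / fact (n + 1 - k)))"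
  proof (cases "m \<le> n")
    case True
    \<comment> \<open>The resulting \<open>fact k\<close> in the denominator cancels the prefactor,
      and \<open>n - m\<close> is \<open>n + 1 - k\<close>.\<close>
    then have "Suc n - (n - m) = k"
      by (simp add: k)
    then have "real (Suc n choose (n - m)) = fact (Suc n) / (fact (n - m) * fact k)"
      by (simp add: binomial_fact del: fact_Suc)
    \<comment> \<open>Here \<open>m \<ge> 1\<close> matters: for \<open>k = 1\<close> truncated
      subtraction gives \<open>k - 2 = 0\<close>, and \<open>n = 0\<close> would land in the wrong
      case.\<close>
    moreover have "\<not> n \<le> k - 2"
      using True \<open>m \<ge> 1\<close> k by simp
    ultimately show ?thesis
      using True by (simp add: k del: fact_Suc)
  next
    case False
    then show ?thesis
      by (simp add: k)
  qed
  finally show ?thesis .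
qed

end
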